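(* Let $\alpha$ be a positive rational number and let $\mathcal T_1=(T_1,\nu_1)$ and $\mathcal T_2=(T_2,\nu_2)$ be factorization trees for $\alpha$. If $\sigma$ is a homomorphism from $\mathcal T_1$ to $\mathcal T_2$, then (i) $\sigma$ is injective and edge-preserving, and (ii) if $\tau$ is any homomorphism from $\mathcal T_1$ to $\mathcal T_2$ then $\sigma=\tau$.
   Context: Write $\alpha=a/b$ with $a,b$ coprime positive integers. Let $p_1\ge\cdots\ge p_N$ be the primes dividing $ab$, listed with multiplicity. Put $\gamma(i)=1$ if $p_i\mid a$, $\gamma(i)=-1$ if $p_i\mid b$, and $\alpha_n=\prod_{i=1}^n p_i^{\gamma(i)}$ for $0\le n\le N$ (so $\alpha_0=1$, $\alpha_N=\alpha$). A factorization of a positive rational $\beta$ is a sequence $(a_1/b_1,a_2/b_2,\dots)$ with $a_i,b_i$ positive integers, $a_i=b_i=1$ for all but finitely many $i$, $\prod_i a_i/b_i=\beta$, $\max\{a_i,b_i\}\ge\max\{a_{i+1},b_{i+1}\}$ for all $i$, and $\gcd(a_i,b_j)=1$ for all $i,j$. Let $\mathfrak F_\alpha$ be the set of all factorizations of $\alpha_n$, $0\le n\le N$. For $0\le n<N$, a factorization $(a_i/b_i)$ of $\alpha_n$ is a direct subfactorization of a factorization $(c_i/d_i)$ of $\alpha_{n+1}$ if either $p_{n+1}\mid a$ and for some $k$: $d_i=b_i$ for all $i$, $c_i=a_i$ for $i\ne k$, $c_k=a_kp_{n+1}$; or $p_{n+1}\mid b$ and for some $k$: $c_i=a_i$ for all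 $i$, $d_i=b_i$ for $i\ne k$, $d_k=b_kp_{n+1}$. A tree data structure for a set $X$ is a pair $(T,\nu)$ where $T$ is a rooted tree, viewed as a digraph with an edge $(r,s)$ from each vertex to each of its children, and $\nu:V(T)\to X$ is a map; its parenting map $\phi$ sends each non-root vertex to its parent. A factorization tree for $\alpha$ is a tree data structure $(T,\nu)$ for $\mathfrak F_\alpha$ such that: (1) the root $r_0$ satisfies $\nu(r_0)=(1,1,\dots)$; (2) if $n<N$ and $\nu(r)$ is a factorization of $\alpha_n$ then $r$ has at least one child; (3) if $\nu(r)=\nu(s)$ and $\phi(r)=\phi(s)$ then $r=s$; (4) for each non-root vertex $r$, $\nu(\phi(r))$ is a direct subfactorization of $\nu(r)$. A homomorphism from $(T_1,\nu_1)$ to $(T_2,\nu_2)$ is a map $\sigma:V(T_1)\to V(T_2)$ with $(\sigma(g),\sigma(h))\in E(T_2)$ whenever $(g,h)\in E(T_1)$ and $\nu_2(\sigma(r))=\nu_1(r)$ for all $r$. It is edge-preserving if $(g,h)\in E(T_1)\iff(\sigma(g),\sigma(h))\in E(T_2)$. *)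

theory Defs
  imports
    "HOL-Library.Multiset"
    "HOL-Library.FuncSet"
    "HOL-Library.Groups_Big_Fun"
    "HOL-Computational_Algebra.Primes"
    "Graph_Theory.Pair_Digraph"
begin

section \<open>Factorizations\<close>

text \<open>\<open>\<alpha> = numer \<alpha> / denom \<alpha>\<close> in lowest terms, for \<open>\<alpha> > 0\<close>.\<close>

definition numer :: "rat \<Rightarrow> nat" where
  "numer \<alpha> = nat (fst (quotient_of \<alpha>))"

definition denom :: "rat \<Rightarrow> nat" where
  "denom \<alpha> = nat (snd (quotient_of \<alpha>))"

definition prime_list :: "rat \<Rightarrow> nat list" where
  "prime_list \<alpha> = rev (sorted_list_of_multiset (prime_factorization (numer \<alpha> * denom \<alpha>)))"

definition num_primes :: "rat \<Rightarrow> nat" where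
  "num_primes \<alpha> = length (prime_list \<alpha>)"

text \<open>The primes are numbered from 1: \<open>nth_prime \<alpha> i\<close> is meaningful for
  \<open>1 \<le> i \<le> num_primes \<alpha>\<close>.\<close>

definition nth_prime :: "rat \<Rightarrow> nat \<Rightarrow> nat" where
  "nth_prime \<alpha> i = prime_list \<alpha> ! (i - 1)"

definition prime_sign :: "rat \<Rightarrow> nat \<Rightarrow> int" where
  "prime_sign \<alpha> i = (if nth_prime \<alpha> i dvd numer \<alpha> then 1 else -1)"

definition partial_value :: "rat \<Rightarrow> nat \<Rightarrow> rat" where
  "partial_value \<alpha> n = (\<Prod>i = 1..n. of_nat (nth_prime \<alpha> i) powi prime_sign \<alpha> i)"

text \<open>A sequence of fractions \<open>a\<^sub>i / b\<^sub>i\<close> is given by the pairs \<open>(a\<^sub>i, b\<^sub>i)\<close>, indexed from 0.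
  For a factorization these pairs are in lowest terms, so they are determined by the
  rational numbers \<open>a\<^sub>i / b\<^sub>i\<close>.\<close>

type_synonym frac_seq = "nat \<Rightarrow> nat \<times> nat"

definition is_factorization :: "rat \<Rightarrow> frac_seq \<Rightarrow> bool" where
  "is_factorization \<beta> f \<longleftrightarrow>
     (\<forall>i. 0 < fst (f i) \<and> 0 < snd (f i)) \<and>
     finite {i. f i \<noteq> (1, 1)} \<and>
     (\<Prod>i. of_nat (fst (f i)) / of_nat (snd (f i))) = \<beta> \<and>
     (\<forall>i. max (fst (f i)) (snd (f i)) \<ge> max (fst (f (Suc i))) (snd (f (Suc i)))) \<and>
     (\<forall>i j. gcd (fst (f i)) (snd (f j)) = 1)"

definition all_factorizations :: "rat \<Rightarrow> frac_seq set" where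
  "all_factorizations \<alpha> = {f. \<exists>n \<le> num_primes \<alpha>. is_factorization (partial_value \<alpha> n) f}"

definition direct_subfactorization :: "rat \<Rightarrow> frac_seq \<Rightarrow> frac_seq \<Rightarrow> bool" where
  "direct_subfactorization \<alpha> f g \<longleftrightarrow>
     (\<exists>n < num_primes \<alpha>.
        is_factorization (partial_value \<alpha> n) f \<and>
        is_factorization (partial_value \<alpha> (n + 1)) g \<and>
        (nth_prime \<alpha> (n + 1) dvd numer \<alpha> \<and>
           (\<exists>k. (\<forall>i. snd (g i) = snd (f i)) \<and>
                (\<forall>i. i \<noteq> k \<longrightarrow> fst (g i) = fst (f i)) \<and>
                fst (g k) = fst (f k) * nth_prime \<alpha> (n + 1))
         \<or>
         nth_prime \<alpha> (n + 1) dvd denom \<alpha> \<and>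
           (\<exists>k. (\<forall>i. fst (g i) = fst (f i)) \<and>
                (\<forall>i. i \<noteq> k \<longrightarrow> snd (g i) = snd (f i)) \<and>
                snd (g k) = snd (f k) * nth_prime \<alpha> (n + 1))))"

section \<open>Rooted trees and tree data structures\<close>

text \<open>A rooted tree, with its edges directed away from the root, is a digraph having exactly
  one directed walk from the root to each vertex. No finiteness is required. (In the library,
  \<open>tree\<close> only excludes directed cycles, so it also admits digraphs whose underlying
  undirected graph has cycles.)\<close>

definition rooted_tree :: "'v pair_pre_digraph \<Rightarrow> 'v \<Rightarrow> bool" where
  "rooted_tree T r\<^sub>0 \<longleftrightarrow>
     pair_wf_digraph T \<and> r\<^sub>0 \<in> pverts T \<and>
     (\<forall>v \<in> pverts T. \<exists>!p. pre_digraph.awalk (with_proj T) r\<^sub>0 p v)"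

text \<open>The parenting map; meaningful only at vertices of \<open>T\<close> other than the root.\<close>

definition parent :: "'v pair_pre_digraph \<Rightarrow> 'v \<Rightarrow> 'v" where
  "parent T r = (THE q. (q, r) \<in> parcs T)"

definition tree_data_structure ::
    "'x set \<Rightarrow> 'v pair_pre_digraph \<Rightarrow> 'v \<Rightarrow> ('v \<Rightarrow> 'x) \<Rightarrow> bool" where
  "tree_data_structure X T r\<^sub>0 \<nu> \<longleftrightarrow> rooted_tree T r\<^sub>0 \<and> \<nu> \<in> pverts T \<rightarrow> X"

definition factorization_tree ::
    "rat \<Rightarrow> 'v pair_pre_digraph \<Rightarrow> 'v \<Rightarrow> ('v \<Rightarrow> frac_seq) \<Rightarrow> bool" where
  "factorization_tree \<alpha> T r\<^sub>0 \<nu> \<longleftrightarrow>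
     tree_data_structure (all_factorizations \<alpha>) T r\<^sub>0 \<nu> \<and>
     \<nu> r\<^sub>0 = (\<lambda>_. (1, 1)) \<and>
     (\<forall>r \<in> pverts T. \<forall>n < num_primes \<alpha>.
        is_factorization (partial_value \<alpha> n) (\<nu> r) \<longrightarrow> (\<exists>s. (r, s) \<in> parcs T)) \<and>
     (\<forall>r \<in> pverts T - {r\<^sub>0}. \<forall>s \<in> pverts T - {r\<^sub>0}.
        \<nu> r = \<nu> s \<and> parent T r = parent T s \<longrightarrow> r = s) \<and>
     (\<forall>r \<in> pverts T - {r\<^sub>0}. direct_subfactorization \<alpha> (\<nu> (parent T r)) (\<nu> r))"

text \<open>Only the values of \<open>\<sigma>\<close> on the vertices of \<open>T\<^sub>1\<close> are relevant.\<close>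

definition tree_hom ::
    "'v pair_pre_digraph \<Rightarrow> ('v \<Rightarrow> 'x) \<Rightarrow> 'w pair_pre_digraph \<Rightarrow> ('w \<Rightarrow> 'x) \<Rightarrow> ('v \<Rightarrow> 'w) \<Rightarrow> bool" where
  "tree_hom T\<^sub>1 \<nu>\<^sub>1 T\<^sub>2 \<nu>\<^sub>2 \<sigma> \<longleftrightarrow>
     \<sigma> \<in> pverts T\<^sub>1 \<rightarrow> pverts T\<^sub>2 \<and>
     (\<forall>g h. (g, h) \<in> parcs T\<^sub>1 \<longrightarrow> (\<sigma> g, \<sigma> h) \<in> parcs T\<^sub>2) \<and>
     (\<forall>r \<in> pverts T\<^sub>1. \<nu>\<^sub>2 (\<sigma> r) = \<nu>\<^sub>1 r)"

definition edge_preserving ::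
    "'v pair_pre_digraph \<Rightarrow> 'w pair_pre_digraph \<Rightarrow> ('v \<Rightarrow> 'w) \<Rightarrow> bool" where
  "edge_preserving T\<^sub>1 T\<^sub>2 \<sigma> \<longleftrightarrow>
     (\<forall>g \<in> pverts T\<^sub>1. \<forall>h \<in> pverts T\<^sub>1. (g, h) \<in> parcs T\<^sub>1 \<longleftrightarrow> (\<sigma> g, \<sigma> h) \<in> parcs T\<^sub>2)"

end

theory Submission
  imports Defs
begin

text \<open>In a factorization tree only the root carries the label \<open>(1, 1, \<dots>)\<close>, because every step to a
  child multiplies an entry by a prime; so a homomorphism maps the root, and only the root, to the
  root. Since a vertex is determined by its parent and its label, both injectivity and uniqueness
  propagate from the root along the edges, and an edge between image vertices comes from an edge
  because parents are unique.\<close>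

lemma rooted_tree_awalk_unique:
  assumes "rooted_tree T r\<^sub>0" "pre_digraph.awalk (with_proj T) r\<^sub>0 p v"
    "pre_digraph.awalk (with_proj T) r\<^sub>0 q v"
  shows "p = q"
proof -
  interpret pair_wf_digraph T
    using assms(1) by (simp add: rooted_tree_def)
  have "v \<in> pverts T"
    using assms(2) awalk_last_in_verts by fastforce
  then show ?thesis
    using assms by (auto simp: rooted_tree_def)
qed

lemma rooted_tree_awalk_snoc:
  assumes "rooted_tree T r\<^sub>0" "(g, h) \<in> parcs T"
  obtains p where "pre_digraph.awalk (with_proj T) r\<^sub>0 (p @ [(g, h)]) h"
proof -
  interpret pair_wf_digraph T
    using assms(1) by (simp add: rooted_tree_def)
  have "g \<in> pverts T"
    using assms(2) in_arcsD1 by blast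
  then obtain p where "awalk r\<^sub>0 p g"
    using assms(1) by (auto simp: rooted_tree_def)
  moreover have "awalk g [(g, h)] h"
    using arc_implies_awalk[of "(g, h)"] assms(2) by simp
  ultimately show ?thesis
    using that awalk_appendI by blast
qed

text \<open>Such an arc would end a nonempty walk from the root back to itself, in competition with
  the empty walk.\<close>

lemma rooted_tree_no_arc_to_root:
  assumes "rooted_tree T r\<^sub>0"
  shows "(g, r\<^sub>0) \<notin> parcs T"
proof
  assume "(g, r\<^sub>0) \<in> parcs T"
  then obtain p where p: "pre_digraph.awalk (with_proj T) r\<^sub>0 (p @ [(g, r\<^sub>0)]) r\<^sub>0"
    by (rule rooted_tree_awalk_snoc[OF assms])
  interpret pair_wf_digraph T
    using assms by (simp add: rooted_tree_def)
  have "awalk r\<^sub>0 [] r\<^sub>0"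
    using assms by (simp add: rooted_tree_def awalk_Nil_iff)
  with p show False
    using rooted_tree_awalk_unique[OF assms] by blast
qed

text \<open>Each of the two arcs is the last arc of a walk from the root to \<open>h\<close>, and
  these walks coincide.\<close>

lemma rooted_tree_parent_unique:
  assumes "rooted_tree T r\<^sub>0" "(g, h) \<in> parcs T" "(g', h) \<in> parcs T"
  shows "g = g'"
  by (metis Pair_inject assms last_snoc rooted_tree_awalk_snoc rooted_tree_awalk_unique)

lemma rooted_tree_parent_eq:
  assumes "rooted_tree T r\<^sub>0" "(g, h) \<in> parcs T"
  shows "parent T h = g"
  unfolding parent_def using assms by (blast intro: rooted_tree_parent_unique)

text \<open>Induction on the walk from the root to \<open>v\<close>, a finite list even when
  \<open>T\<close> is infinite; the last arc is split off each time.\<close>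

lemma rooted_tree_induct [consumes 2, case_names root arc]:
  assumes "rooted_tree T r\<^sub>0" "v \<in> pverts T"
    and root: "P r\<^sub>0"
    and arc: "\<And>g h. (g, h) \<in> parcs T \<Longrightarrow> P g \<Longrightarrow> P h"
  shows "P v"
proof -
  interpret pair_wf_digraph T
    using assms(1) by (simp add: rooted_tree_def)
  obtain p where "awalk r\<^sub>0 p v"
    using assms(1,2) by (auto simp: rooted_tree_def)
  then show ?thesis
  proof (induction p arbitrary: v rule: rev_induct)
    case Nil
    then show ?case using root by (simp add: awalk_Nil_iff)
  next
    case (snoc e p)
    then have "awalk r\<^sub>0 p (fst e)" "e \<in> parcs T" "snd e = v"
      by (auto simp: awalk_append_iff awalk_Cons_iff awalk_Nil_iff)
    with snoc.IH arc show ?case by (metis prod.collapse)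
  qed
qed

lemma rooted_tree_arc_to_nonroot:
  assumes "rooted_tree T r\<^sub>0" "v \<in> pverts T" "v \<noteq> r\<^sub>0"
  obtains g where "(g, v) \<in> parcs T"
  using assms by (induction rule: rooted_tree_induct) auto

lemma rooted_tree_arcD:
  assumes "rooted_tree T r\<^sub>0" "(g, h) \<in> parcs T"
  shows "g \<in> pverts T" "h \<in> pverts T" "h \<noteq> r\<^sub>0"
proof -
  interpret pair_wf_digraph T
    using assms(1) by (simp add: rooted_tree_def)
  show "g \<in> pverts T" "h \<in> pverts T"
    using assms(2) in_arcsD1 in_arcsD2 by blast+
  show "h \<noteq> r\<^sub>0"
    using assms rooted_tree_no_arc_to_root by metis
qed

lemma prime_nth_prime:
  assumes "n < num_primes \<alpha>"
  shows "prime (nth_prime \<alpha> (n + 1))"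
proof -
  have "nth_prime \<alpha> (n + 1) \<in> set (prime_list \<alpha>)"
    using assms by (simp add: nth_prime_def num_primes_def)
  then show ?thesis
    by (auto simp: prime_list_def)
qed

text \<open>The numerator or denominator that was changed is a multiple of a prime, so it cannot be
  1.\<close>

lemma direct_subfactorization_not_one: "\<not> direct_subfactorization \<alpha> f (\<lambda>_. (1, 1))"
  unfolding direct_subfactorization_def using prime_nth_prime not_prime_1
  by (metis fst_conv snd_conv nat_mult_eq_1_iff)

lemma factorization_tree_rooted: "factorization_tree \<alpha> T r\<^sub>0 \<nu> \<Longrightarrow> rooted_tree T r\<^sub>0"
  by (simp add: factorization_tree_def tree_data_structure_def)

lemma factorization_tree_label_one_iff:
  assumes "factorization_tree \<alpha> T r\<^sub>0 \<nu>" "v \<in> pverts T"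
  shows "\<nu> v = (\<lambda>_. (1, 1)) \<longleftrightarrow> v = r\<^sub>0"
  using assms direct_subfactorization_not_one[of \<alpha> "\<nu> (parent T v)"]
  unfolding factorization_tree_def by (metis DiffI singletonD)

text \<open>Condition (3) on factorization trees, restated with arcs in place of
  \<open>parent\<close>, which is how homomorphisms speak of edges.\<close>

lemma factorization_tree_sibling_eq:
  assumes "factorization_tree \<alpha> T r\<^sub>0 \<nu>" "(g, h) \<in> parcs T" "(g, h') \<in> parcs T" "\<nu> h = \<nu> h'"
  shows "h = h'"
proof -
  note tree = factorization_tree_rooted[OF assms(1)]
  have "parent T h = parent T h'"
    using rooted_tree_parent_eq[OF tree] assms(2,3) by metis
  then show ?thesis
    using assms(1,4) rooted_tree_arcD[OF tree assms(2)] rooted_tree_arcD[OF tree assms(3)]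
    by (auto simp: factorization_tree_def)
qed

lemma tree_hom_arc:
  assumes "tree_hom T\<^sub>1 \<nu>\<^sub>1 T\<^sub>2 \<nu>\<^sub>2 \<sigma>" "(g, h) \<in> parcs T\<^sub>1"
  shows "(\<sigma> g, \<sigma> h) \<in> parcs T\<^sub>2"
  using assms by (simp add: tree_hom_def)

lemma tree_hom_label:
  assumes "tree_hom T\<^sub>1 \<nu>\<^sub>1 T\<^sub>2 \<nu>\<^sub>2 \<sigma>" "v \<in> pverts T\<^sub>1"
  shows "\<nu>\<^sub>2 (\<sigma> v) = \<nu>\<^sub>1 v"
  using assms by (simp add: tree_hom_def)

lemma tree_hom_eq_root_iff:
  assumes "factorization_tree \<alpha> T\<^sub>1 r\<^sub>1 \<nu>\<^sub>1" "factorization_tree \<alpha> T\<^sub>2 r\<^sub>2 \<nu>\<^sub>2"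
    and "tree_hom T\<^sub>1 \<nu>\<^sub>1 T\<^sub>2 \<nu>\<^sub>2 \<sigma>" "v \<in> pverts T\<^sub>1"
  shows "\<sigma> v = r\<^sub>2 \<longleftrightarrow> v = r\<^sub>1"
proof -
  have "\<sigma> v \<in> pverts T\<^sub>2" "\<nu>\<^sub>2 (\<sigma> v) = \<nu>\<^sub>1 v"
    using assms(3,4) by (auto simp: tree_hom_def)
  then show ?thesis
    using factorization_tree_label_one_iff[OF assms(1,4)]
      factorization_tree_label_one_iff[OF assms(2)] by metis
qed

lemma tree_hom_inj_on:
  assumes tree1: "factorization_tree \<alpha> T\<^sub>1 r\<^sub>1 \<nu>\<^sub>1" and tree2: "factorization_tree \<alpha> T\<^sub>2 r\<^sub>2 \<nu>\<^sub>2"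
    and hom: "tree_hom T\<^sub>1 \<nu>\<^sub>1 T\<^sub>2 \<nu>\<^sub>2 \<sigma>"
  shows "inj_on \<sigma> (pverts T\<^sub>1)"
proof -
  note rooted1 = factorization_tree_rooted[OF tree1]
  note rooted2 = factorization_tree_rooted[OF tree2]
  note root_iff = tree_hom_eq_root_iff[OF tree1 tree2 hom]
  \<comment> \<open>The quantifier over \<open>w\<close> belongs to the induction claim, since the
    hypothesis for the parent of \<open>v\<close> is applied to the parent of
    \<open>w\<close>.\<close>
  have "\<forall>w \<in> pverts T\<^sub>1. \<sigma> v = \<sigma> w \<longrightarrow> v = w" if "v \<in> pverts T\<^sub>1" for v
    using rooted1 that
  proof (induction rule: rooted_tree_induct)
    case root
    have "r\<^sub>1 \<in> pverts T\<^sub>1"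
      using rooted1 by (simp add: rooted_tree_def)
    then show ?case
      using root_iff by metis
  next
    case (arc g h)
    note h = rooted_tree_arcD[OF rooted1 arc.hyps]
    show ?case
    proof (intro ballI impI)
      fix w assume w: "w \<in> pverts T\<^sub>1" "\<sigma> h = \<sigma> w"
      then have "w \<noteq> r\<^sub>1"
        using root_iff h by metis
      then obtain g' where g': "(g', w) \<in> parcs T\<^sub>1"
        using rooted_tree_arc_to_nonroot[OF rooted1 w(1)] by blast
      \<comment> \<open>Both parents are sent to a parent of the common image of \<open>h\<close>
        and \<open>w\<close>, so their images agree.\<close>
      have "(\<sigma> g, \<sigma> h) \<in> parcs T\<^sub>2" "(\<sigma> g', \<sigma> h) \<in> parcs T\<^sub>2"
        using tree_hom_arc[OF hom arc.hyps] tree_hom_arc[OF hom g'] w(2) by simp_all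
      then have "\<sigma> g = \<sigma> g'"
        by (rule rooted_tree_parent_unique[OF rooted2])
      then have "g = g'"
        using arc.IH rooted_tree_arcD(1)[OF rooted1 g'] by blast
      moreover have "\<nu>\<^sub>1 h = \<nu>\<^sub>1 w"
        using tree_hom_label[OF hom h(2)] tree_hom_label[OF hom w(1)] w(2) by simp
      ultimately show "h = w"
        using factorization_tree_sibling_eq[OF tree1 arc.hyps] g' by blast
    qed
  qed
  then show ?thesis
    by (auto intro: inj_onI)
qed

text \<open>For the converse direction, the parent of \<open>h\<close> in the first tree is mapped
  to the parent of \<sigma> \<open>h\<close>, which is \<sigma> \<open>g\<close>; injectivity then
  identifies it with \<open>g\<close>.\<close>

lemma tree_hom_edge_preserving:
  assumes tree1: "factorization_tree \<alpha> T\<^sub>1 r\<^sub>1 \<nu>\<^sub>1" and tree2: "factorization_tree \<alpha> T\<^sub>2 r\<^sub>2 \<nu>\<^sub>2"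
    and hom: "tree_hom T\<^sub>1 \<nu>\<^sub>1 T\<^sub>2 \<nu>\<^sub>2 \<sigma>"
  shows "edge_preserving T\<^sub>1 T\<^sub>2 \<sigma>"
proof -
  note rooted1 = factorization_tree_rooted[OF tree1]
  note rooted2 = factorization_tree_rooted[OF tree2]
  have "(g, h) \<in> parcs T\<^sub>1"
    if gh: "g \<in> pverts T\<^sub>1" "h \<in> pverts T\<^sub>1" "(\<sigma> g, \<sigma> h) \<in> parcs T\<^sub>2" for g h
  proof -
    \<comment> \<open>Otherwise \<sigma> \<open>h\<close> would be the root
      \<open>r\<^sub>2\<close>, which no arc enters.\<close>
    have "h \<noteq> r\<^sub>1"
      using tree_hom_eq_root_iff[OF tree1 tree2 hom gh(2)] rooted_tree_arcD[OF rooted2 gh(3)]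
      by blast
    then obtain g' where g': "(g', h) \<in> parcs T\<^sub>1"
      using rooted_tree_arc_to_nonroot[OF rooted1 gh(2)] by blast
    then have "(\<sigma> g', \<sigma> h) \<in> parcs T\<^sub>2"
      by (rule tree_hom_arc[OF hom])
    then have "\<sigma> g' = \<sigma> g"
      using gh(3) by (rule rooted_tree_parent_unique[OF rooted2])
    then have "g' = g"
      using tree_hom_inj_on[OF tree1 tree2 hom] gh(1) rooted_tree_arcD(1)[OF rooted1 g']
      by (meson inj_onD)
    with g' show ?thesis by simp
  qed
  then show ?thesis
    using tree_hom_arc[OF hom] by (auto simp: edge_preserving_def)
qed

text \<open>Going down from the root, the two images of a vertex are children of the same vertex
  with the same label, hence equal.\<close>

lemma tree_hom_unique:
  assumes tree1: "factorization_tree \<alpha> T\<^sub>1 r\<^sub>1 \<nu>\<^sub>1" and tree2: "factorization_tree \<alpha> T\<^sub>2 r\<^sub>2 \<nu>\<^sub>2"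
    and homs: "tree_hom T\<^sub>1 \<nu>\<^sub>1 T\<^sub>2 \<nu>\<^sub>2 \<sigma>" "tree_hom T\<^sub>1 \<nu>\<^sub>1 T\<^sub>2 \<nu>\<^sub>2 \<tau>"
    and "v \<in> pverts T\<^sub>1"
  shows "\<sigma> v = \<tau> v"
  using factorization_tree_rooted[OF tree1] \<open>v \<in> pverts T\<^sub>1\<close>
proof (induction rule: rooted_tree_induct)
  case root
  have "r\<^sub>1 \<in> pverts T\<^sub>1"
    using factorization_tree_rooted[OF tree1] by (simp add: rooted_tree_def)
  then show ?case
    using homs[THEN tree_hom_eq_root_iff[OF tree1 tree2]] by metis
next
  case (arc g h)
  \<comment> \<open>The second arc is the image under \<tau>, its source rewritten by the induction
    hypothesis.\<close>
  have "(\<sigma> g, \<sigma> h) \<in> parcs T\<^sub>2" "(\<sigma> g, \<tau> h) \<in> parcs T\<^sub>2"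
    using homs[THEN tree_hom_arc, OF arc.hyps] arc.IH by auto
  moreover have "\<nu>\<^sub>2 (\<sigma> h) = \<nu>\<^sub>2 (\<tau> h)"
    using homs[THEN tree_hom_label]
      rooted_tree_arcD(2)[OF factorization_tree_rooted[OF tree1] arc.hyps]
    by simp
  ultimately show ?case
    by (rule factorization_tree_sibling_eq[OF tree2])
qed

theorem theorem2p3:
  fixes \<alpha> :: rat
    and T\<^sub>1 :: "'v pair_pre_digraph" and r\<^sub>1 :: 'v and \<nu>\<^sub>1 :: "'v \<Rightarrow> frac_seq"
    and T\<^sub>2 :: "'w pair_pre_digraph" and r\<^sub>2 :: 'w and \<nu>\<^sub>2 :: "'w \<Rightarrow> frac_seq"
    and \<sigma> :: "'v \<Rightarrow> 'w"
  assumes "\<alpha> > 0"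
    and "factorization_tree \<alpha> T\<^sub>1 r\<^sub>1 \<nu>\<^sub>1"
    and "factorization_tree \<alpha> T\<^sub>2 r\<^sub>2 \<nu>\<^sub>2"
    and "tree_hom T\<^sub>1 \<nu>\<^sub>1 T\<^sub>2 \<nu>\<^sub>2 \<sigma>"
  shows "(inj_on \<sigma> (pverts T\<^sub>1) \<and> edge_preserving T\<^sub>1 T\<^sub>2 \<sigma>) \<and>
         (\<forall>\<tau>. tree_hom T\<^sub>1 \<nu>\<^sub>1 T\<^sub>2 \<nu>\<^sub>2 \<tau> \<longrightarrow> (\<forall>v \<in> pverts T\<^sub>1. \<sigma> v = \<tau> v))"
  using tree_hom_inj_on[OF assms(2-4)] tree_hom_edge_preserving[OF assms(2-4)]
    tree_hom_unique[OF assms(2-4)] by blast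

end
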